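(* Let $G$ be a tame $\ell_c$-group. For any $M\in\mathcal{R}(G)$ and $\pi\in\widehat{G}$, the quotient $$M_{\pi}=M\Big/\bigcap_{f\in\operatorname{Hom}_G(M,\pi)}\ker f$$ lies in $\mathcal{R}(G)_{\pi}$, i.e. its support is contained in $\{\pi\}$.
   Context: An $\ell$-group is a Hausdorff, locally compact, totally disconnected topological group. An $\ell_c$-group is an $\ell$-group which is a filtered union of its compact open subgroups (every element lies in a compact open subgroup, and any two compact open subgroups are contained in a third). A complex representation $(\pi,V)$ of an $\ell$-group $G$ is smooth if every vector of $V$ has open stabilizer in $G$; it is admissible if in addition $V^K$ is finite-dimensional for every compact open subgroup $K \subset G$. An $\ell$-group is tame if all its irreducible smooth representations are admissible. $\mathcal{R}(G)$ is the category of smooth representations of $G$, and $\widehat{G}$ is the set of isomorphism classes of irreducible smooth representations of $G$. The support of $M\in\mathcal{R}(G)$ is $\operatorname{Supp} M=\{\pi\in\widehat{G} \mid \operatorname{Hom}_G(M,\pi)\neq 0\}$; $\mathcal{R}(G)_{\pi}$ is the full subcategory of $\mathcal{R}(G)$ of representations with support contained in $\{\pi\}$. *)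

theory Defs
  imports "HOL-Analysis.Analysis" "HOL-Algebra.Algebra" "HOL-Algebra.Algebraic_Closure_Type"
begin

locale topological_group = group G for G :: "('g, 'b) monoid_scheme" (structure) and T :: "'g topology" +
  assumes topspace_eq: "topspace T = carrier G"
    and continuous_mult: "continuous_map (prod_topology T T) T (\<lambda>(x, y). x \<otimes> y)"
    and continuous_inv: "continuous_map T T (\<lambda>x. inv x)"

locale ell_group = topological_group +
  assumes Hausdorff: "Hausdorff_space T"
    and locally_compact: "locally_compact_space T"
    and totally_disconnected: "\<And>x. x \<in> topspace T \<Longrightarrow> connected_component_of_set T x = {x}"

definition compact_open_subgroup :: "('g, 'b) monoid_scheme \<Rightarrow> 'g topology \<Rightarrow> 'g set \<Rightarrow> bool"
  where "compact_open_subgroup G T K \<longleftrightarrow> subgroup K G \<and> compactin T K \<and> openin T K"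

locale ell_c_group = ell_group +
  assumes covered: "\<And>x. x \<in> carrier G \<Longrightarrow> \<exists>K. compact_open_subgroup G T K \<and> x \<in> K"
    and filtered: "\<And>K L. \<lbrakk>compact_open_subgroup G T K; compact_open_subgroup G T L\<rbrakk>
      \<Longrightarrow> \<exists>N. compact_open_subgroup G T N \<and> K \<subseteq> N \<and> L \<subseteq> N"

abbreviation complex_field :: "complex ring"
  where "complex_field \<equiv> ring_of_type_algebra"

text \<open>
  The record \<open>module\<close> extends \<open>ring\<close>; as for all modules of the library, its fields
  \<open>mult\<close> and \<open>one\<close> carry no information here.
\<close>

record ('g, 'v) rep = "(complex, 'v) module" +
  act :: "'g \<Rightarrow> 'v \<Rightarrow> 'v"

locale representation =
  G?: group G + V?: Module.module complex_field V
  for G :: "('g, 'b) monoid_scheme" (structure) and V :: "('g, 'v) rep" (structure) +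
  assumes act_closed: "\<lbrakk>g \<in> carrier G; v \<in> carrier V\<rbrakk> \<Longrightarrow> act V g v \<in> carrier V"
    and act_add: "\<lbrakk>g \<in> carrier G; v \<in> carrier V; w \<in> carrier V\<rbrakk>
      \<Longrightarrow> act V g (v \<oplus>\<^bsub>V\<^esub> w) = act V g v \<oplus>\<^bsub>V\<^esub> act V g w"
    and act_smult: "\<lbrakk>g \<in> carrier G; v \<in> carrier V\<rbrakk>
      \<Longrightarrow> act V g (c \<odot>\<^bsub>V\<^esub> v) = c \<odot>\<^bsub>V\<^esub> act V g v"
    and act_one: "v \<in> carrier V \<Longrightarrow> act V \<one>\<^bsub>G\<^esub> v = v"
    and act_mult: "\<lbrakk>g \<in> carrier G; h \<in> carrier G; v \<in> carrier V\<rbrakk>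
      \<Longrightarrow> act V (g \<otimes>\<^bsub>G\<^esub> h) v = act V g (act V h v)"

definition stabilizer_of :: "('g, 'b) monoid_scheme \<Rightarrow> ('g, 'v) rep \<Rightarrow> 'v \<Rightarrow> 'g set"
  where "stabilizer_of G V v = {g \<in> carrier G. act V g v = v}"

definition smooth_rep :: "('g, 'b) monoid_scheme \<Rightarrow> 'g topology \<Rightarrow> ('g, 'v) rep \<Rightarrow> bool"
  where "smooth_rep G T V \<longleftrightarrow>
    representation G V \<and> (\<forall>v\<in>carrier V. openin T (stabilizer_of G V v))"

definition fixed_vectors :: "('g, 'v) rep \<Rightarrow> 'g set \<Rightarrow> 'v set"
  where "fixed_vectors V K = {v \<in> carrier V. \<forall>k\<in>K. act V k v = v}"

definition finite_dim :: "('g, 'v) rep \<Rightarrow> 'v set \<Rightarrow> bool"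
  where "finite_dim V W \<longleftrightarrow>
    (\<exists>B. finite B \<and> B \<subseteq> W \<and> (\<forall>w\<in>W. \<exists>c :: 'v \<Rightarrow> complex. w = (\<Oplus>\<^bsub>V\<^esub>b\<in>B. c b \<odot>\<^bsub>V\<^esub> b)))"

definition admissible_rep :: "('g, 'b) monoid_scheme \<Rightarrow> 'g topology \<Rightarrow> ('g, 'v) rep \<Rightarrow> bool"
  where "admissible_rep G T V \<longleftrightarrow> smooth_rep G T V \<and>
    (\<forall>K. compact_open_subgroup G T K \<longrightarrow> finite_dim V (fixed_vectors V K))"

definition subrepresentation :: "('g, 'b) monoid_scheme \<Rightarrow> ('g, 'v) rep \<Rightarrow> 'v set \<Rightarrow> bool"
  where "subrepresentation G V W \<longleftrightarrow>
    submodule W complex_field V \<and> (\<forall>g\<in>carrier G. \<forall>w\<in>W. act V g w \<in> W)"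

definition irreducible_rep :: "('g, 'b) monoid_scheme \<Rightarrow> ('g, 'v) rep \<Rightarrow> bool"
  where "irreducible_rep G V \<longleftrightarrow> representation G V \<and> carrier V \<noteq> {\<zero>\<^bsub>V\<^esub>} \<and>
    (\<forall>W. subrepresentation G V W \<longrightarrow> W = {\<zero>\<^bsub>V\<^esub>} \<or> W = carrier V)"

definition irreducible_smooth :: "('g, 'b) monoid_scheme \<Rightarrow> 'g topology \<Rightarrow> ('g, 'v) rep \<Rightarrow> bool"
  where "irreducible_smooth G T V \<longleftrightarrow> irreducible_rep G V \<and> smooth_rep G T V"

definition Hom_G :: "('g, 'b) monoid_scheme \<Rightarrow> ('g, 'v) rep \<Rightarrow> ('g, 'w) rep \<Rightarrow> ('v \<Rightarrow> 'w) set"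
  where "Hom_G G V W = {f \<in> hom (add_monoid V) (add_monoid W).
    (\<forall>c. \<forall>v\<in>carrier V. f (c \<odot>\<^bsub>V\<^esub> v) = c \<odot>\<^bsub>W\<^esub> f v) \<and>
    (\<forall>g\<in>carrier G. \<forall>v\<in>carrier V. f (act V g v) = act W g (f v))}"

definition iso_rep :: "('g, 'b) monoid_scheme \<Rightarrow> ('g, 'v) rep \<Rightarrow> ('g, 'w) rep \<Rightarrow> bool"
  where "iso_rep G V W \<longleftrightarrow> (\<exists>f\<in>Hom_G G V W. bij_betw f (carrier V) (carrier W))"

text \<open>
  Quantification over all irreducible representations needs a fixed carrier type.
  Since an irreducible representation is spanned by the orbit of any nonzero vector, its
  underlying set embeds into the complex functions on the group, so each one is isomorphic to
  one carried by a set of such functions (lemmas \<open>irreducible_smooth_has_std_copy\<close> and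
  \<open>irr_class_in_irr_classes\<close> below).
\<close>

type_synonym 'g std_rep = "('g, 'g \<Rightarrow> complex) rep"

definition tame :: "('g, 'b) monoid_scheme \<Rightarrow> 'g topology \<Rightarrow> bool"
  where "tame G T \<longleftrightarrow> (\<forall>V :: 'g std_rep. irreducible_smooth G T V \<longrightarrow> admissible_rep G T V)"

definition irr_class :: "('g, 'b) monoid_scheme \<Rightarrow> 'g topology \<Rightarrow> ('g, 'v) rep \<Rightarrow> 'g std_rep set"
  where "irr_class G T V = {W. irreducible_smooth G T W \<and> iso_rep G V W}"

definition irr_classes :: "('g, 'b) monoid_scheme \<Rightarrow> 'g topology \<Rightarrow> 'g std_rep set set"
  where "irr_classes G T = irr_class G T ` {V :: 'g std_rep. irreducible_smooth G T V}"

definition Supp :: "('g, 'b) monoid_scheme \<Rightarrow> 'g topology \<Rightarrow> ('g, 'm) rep \<Rightarrow> 'g std_rep set set"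
  \<comment> \<open>nonvanishing of \<open>Hom_G G M P\<close> is independent of the representative \<open>P\<close> of \<open>C\<close>\<close>
  where "Supp G T M = {C \<in> irr_classes G T.
    \<exists>P\<in>C. \<exists>f\<in>Hom_G G M P. \<exists>m\<in>carrier M. f m \<noteq> \<zero>\<^bsub>P\<^esub>}"

text \<open>
  \<open>in_R_pi G T C M\<close>: \<open>M\<close> is an object of the full subcategory of smooth representations
  with support contained in \<open>{C}\<close>.
\<close>

definition in_R_pi ::
    "('g, 'b) monoid_scheme \<Rightarrow> 'g topology \<Rightarrow> 'g std_rep set \<Rightarrow> ('g, 'm) rep \<Rightarrow> bool"
  where "in_R_pi G T C M \<longleftrightarrow> smooth_rep G T M \<and> Supp G T M \<subseteq> {C}"

definition quotient_rep :: "('g, 'v) rep \<Rightarrow> 'v set \<Rightarrow> ('g, 'v set) rep"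
  \<comment> \<open>the unions over a coset make the operations independent of representatives,
    as in \<^const>\<open>rcoset_mult\<close>\<close>
  where "quotient_rep V N =
    \<lparr>carrier = a_rcosets\<^bsub>V\<^esub> N, monoid.mult = undefined, one = undefined,
     ring.zero = N, add = (\<lambda>A B. A <+>\<^bsub>V\<^esub> B),
     smult = (\<lambda>c A. \<Union>a\<in>A. N +>\<^bsub>V\<^esub> (c \<odot>\<^bsub>V\<^esub> a)),
     act = (\<lambda>g A. \<Union>a\<in>A. N +>\<^bsub>V\<^esub> act V g a)\<rparr>"

definition isotypic_quotient ::
    "('g, 'b) monoid_scheme \<Rightarrow> ('g, 'm) rep \<Rightarrow> ('g, 'v) rep \<Rightarrow> ('g, 'm set) rep"
  where "isotypic_quotient G M P = quotient_rep M (\<Inter>f\<in>Hom_G G M P. a_kernel M P f)"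


subsection \<open>Every irreducible smooth representation has a copy on the standard carrier type\<close>

lemma complex_field_simps [simp]:
  "carrier complex_field = UNIV" "\<one>\<^bsub>complex_field\<^esub> = 1" "\<zero>\<^bsub>complex_field\<^esub> = 0"
  "x \<otimes>\<^bsub>complex_field\<^esub> y = x * y" "x \<oplus>\<^bsub>complex_field\<^esub> y = x + y"
  by (simp_all add: ring_of_type_algebra_def)

lemma cring_complex_field: "cring complex_field"
  by (rule cring_from_type_algebra)

definition orbit_sum :: "('g, 'v) rep \<Rightarrow> 'v \<Rightarrow> 'g set \<Rightarrow> ('g \<Rightarrow> complex) \<Rightarrow> 'v"
  where "orbit_sum V v S a = (\<Oplus>\<^bsub>V\<^esub>g\<in>S. a g \<odot>\<^bsub>V\<^esub> act V g v)"

context representation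
begin

lemma orbit_sum_closed:
  assumes "v \<in> carrier V" "S \<subseteq> carrier G"
  shows "orbit_sum V v S a \<in> carrier V"
  unfolding orbit_sum_def using assms by (intro V.M.finsum_closed) (auto intro!: act_closed)

lemma orbit_sum_mono:
  assumes "v \<in> carrier V" "finite S'" "S \<subseteq> S'" "S' \<subseteq> carrier G"
    and "\<And>g. g \<in> S \<Longrightarrow> a g = b g" "\<And>g. g \<in> S' - S \<Longrightarrow> b g = 0"
  shows "orbit_sum V v S a = orbit_sum V v S' b"
proof -
  have null: "0 \<odot>\<^bsub>V\<^esub> x = \<zero>\<^bsub>V\<^esub>" if "x \<in> carrier V" for x
    using V.smult_l_null[OF that] by simp
  show ?thesis
    unfolding orbit_sum_def using assms
    by (intro V.M.add.finprod_mono_neutral_cong_left) (auto intro!: act_closed null)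
qed

lemma act_zero: "g \<in> carrier G \<Longrightarrow> act V g \<zero>\<^bsub>V\<^esub> = \<zero>\<^bsub>V\<^esub>"
  using act_smult[of g "\<zero>\<^bsub>V\<^esub>" 0] V.smult_l_null act_closed by force

lemma act_finsum:
  assumes "finite S" "g \<in> carrier G" "f \<in> S \<rightarrow> carrier V"
  shows "act V g (\<Oplus>\<^bsub>V\<^esub>x\<in>S. f x) = (\<Oplus>\<^bsub>V\<^esub>x\<in>S. act V g (f x))"
  using assms
proof (induction S)
  case empty
  then show ?case by (simp add: act_zero)
next
  case (insert x S)
  then show ?case
    by (subst V.M.finsum_insert V.M.finsum_insert; auto simp: Pi_iff act_add act_closed)+
qed

lemma orbit_span_subrepresentation:
  assumes v: "v \<in> carrier V"
  shows "subrepresentation G V {orbit_sum V v S a | S a. finite S \<and> S \<subseteq> carrier G}"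
    (is "subrepresentation G V ?W")
proof -
  have memI: "orbit_sum V v S a \<in> ?W" if "finite S" "S \<subseteq> carrier G" for S a
    using that by blast
  have sub: "?W \<subseteq> carrier V"
    using orbit_sum_closed[OF v] by auto
  have zero: "\<zero>\<^bsub>V\<^esub> \<in> ?W"
  proof -
    have "\<zero>\<^bsub>V\<^esub> = orbit_sum V v {} (\<lambda>_. 0)" by (simp add: orbit_sum_def)
    then show ?thesis by blast
  qed
  have smult: "c \<odot>\<^bsub>V\<^esub> w \<in> ?W" if w: "w \<in> ?W" for c w
  proof -
    from w obtain S a where S: "finite S" "S \<subseteq> carrier G" "w = orbit_sum V v S a" by blast
    have "c \<odot>\<^bsub>V\<^esub> w = (\<Oplus>\<^bsub>V\<^esub>g\<in>S. c \<odot>\<^bsub>V\<^esub> (a g \<odot>\<^bsub>V\<^esub> act V g v))"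
      unfolding S(3) orbit_sum_def using S v
      by (intro V.finsum_smult_ldistr) (auto intro!: act_closed)
    also have "\<dots> = orbit_sum V v S (\<lambda>g. c * a g)"
      unfolding orbit_sum_def
    proof (intro V.M.finsum_cong' refl)
      fix g assume "g \<in> S"
      then have "act V g v \<in> carrier V" using S v by (blast intro: act_closed)
      then show "c \<odot>\<^bsub>V\<^esub> (a g \<odot>\<^bsub>V\<^esub> act V g v) = (c * a g) \<odot>\<^bsub>V\<^esub> act V g v"
        using V.smult_assoc1[of c "a g" "act V g v"] by simp
    qed (use S v in \<open>auto intro!: act_closed\<close>)
    finally show ?thesis using S by blast
  qed
  have add: "w \<oplus>\<^bsub>V\<^esub> x \<in> ?W" if w: "w \<in> ?W" and x: "x \<in> ?W" for w x
  proof -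
    from w obtain S a where S: "finite S" "S \<subseteq> carrier G" "w = orbit_sum V v S a" by blast
    from x obtain R b where R: "finite R" "R \<subseteq> carrier G" "x = orbit_sum V v R b" by blast
    define a' where "a' = (\<lambda>g. if g \<in> S then a g else 0)"
    define b' where "b' = (\<lambda>g. if g \<in> R then b g else 0)"
    have w': "w = orbit_sum V v (S \<union> R) a'"
      unfolding S(3) by (rule orbit_sum_mono) (use v S R in \<open>auto simp: a'_def\<close>)
    have x': "x = orbit_sum V v (S \<union> R) b'"
      unfolding R(3) by (rule orbit_sum_mono) (use v S R in \<open>auto simp: b'_def\<close>)
    have "orbit_sum V v (S \<union> R) (\<lambda>g. a' g + b' g) =
        (\<Oplus>\<^bsub>V\<^esub>g\<in>S \<union> R. a' g \<odot>\<^bsub>V\<^esub> act V g v \<oplus>\<^bsub>V\<^esub> b' g \<odot>\<^bsub>V\<^esub> act V g v)"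
      unfolding orbit_sum_def
    proof (intro V.M.finsum_cong' refl)
      fix g assume "g \<in> S \<union> R"
      then have "g \<in> carrier G" using S R by auto
      then show "(a' g + b' g) \<odot>\<^bsub>V\<^esub> act V g v = a' g \<odot>\<^bsub>V\<^esub> act V g v \<oplus>\<^bsub>V\<^esub> b' g \<odot>\<^bsub>V\<^esub> act V g v"
        using V.smult_l_distr[of "a' g" "b' g" "act V g v"] v by (simp add: act_closed)
    next
      have "act V g v \<in> carrier V" if "g \<in> S \<union> R" for g
        using that S R v by (blast intro: act_closed)
      then show "(\<lambda>g. a' g \<odot>\<^bsub>V\<^esub> act V g v \<oplus>\<^bsub>V\<^esub> b' g \<odot>\<^bsub>V\<^esub> act V g v) \<in> S \<union> R \<rightarrow> carrier V"
        by simp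
    qed
    also have "\<dots> = w \<oplus>\<^bsub>V\<^esub> x"
      unfolding w' x' orbit_sum_def using S R v
      by (intro V.M.finsum_addf) (auto intro!: act_closed)
    finally have eq: "w \<oplus>\<^bsub>V\<^esub> x = orbit_sum V v (S \<union> R) (\<lambda>g. a' g + b' g)" by simp
    show ?thesis
      unfolding eq using S R by (intro memI) auto
  qed
  have act: "act V h w \<in> ?W" if h: "h \<in> carrier G" and w: "w \<in> ?W" for h w
  proof -
    from w obtain S a where S: "finite S" "S \<subseteq> carrier G" "w = orbit_sum V v S a" by blast
    define b where "b = (\<lambda>g. a (inv\<^bsub>G\<^esub> h \<otimes>\<^bsub>G\<^esub> g))"
    have inj: "inj_on (\<lambda>g. h \<otimes>\<^bsub>G\<^esub> g) S"
      using h S by (intro inj_onI) (metis G.l_cancel subsetD)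
    have sub': "(\<lambda>g. h \<otimes>\<^bsub>G\<^esub> g) ` S \<subseteq> carrier G"
      using h S by auto
    have "act V h w = (\<Oplus>\<^bsub>V\<^esub>g\<in>S. act V h (a g \<odot>\<^bsub>V\<^esub> act V g v))"
      unfolding S(3) orbit_sum_def using S v h
      by (intro act_finsum) (auto intro!: act_closed)
    also have "\<dots> = (\<Oplus>\<^bsub>V\<^esub>g\<in>S. b (h \<otimes>\<^bsub>G\<^esub> g) \<odot>\<^bsub>V\<^esub> act V (h \<otimes>\<^bsub>G\<^esub> g) v)"
    proof (intro V.M.finsum_cong' refl)
      fix g assume "g \<in> S"
      then have g: "g \<in> carrier G" using S by auto
      then have "b (h \<otimes>\<^bsub>G\<^esub> g) = a g"
        using h G.m_assoc[of "inv\<^bsub>G\<^esub> h" h g] by (simp add: b_def)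
      then show "act V h (a g \<odot>\<^bsub>V\<^esub> act V g v) = b (h \<otimes>\<^bsub>G\<^esub> g) \<odot>\<^bsub>V\<^esub> act V (h \<otimes>\<^bsub>G\<^esub> g) v"
        using g h v by (simp add: act_smult act_mult act_closed)
    qed (use S h v in \<open>auto intro!: V.smult_closed act_closed G.m_closed\<close>)
    also have "\<dots> = orbit_sum V v ((\<lambda>g. h \<otimes>\<^bsub>G\<^esub> g) ` S) b"
      unfolding orbit_sum_def using S h v inj
      by (subst V.M.add.finprod_reindex) (auto intro!: V.smult_closed act_closed G.m_closed)
    finally have eq: "act V h w = orbit_sum V v ((\<lambda>g. h \<otimes>\<^bsub>G\<^esub> g) ` S) b" .
    show ?thesis
      unfolding eq using S sub' by (intro memI) auto
  qed
  have neg: "\<ominus>\<^bsub>V\<^esub> w \<in> ?W" if "w \<in> ?W" for w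
  proof -
    have wc: "w \<in> carrier V" using that sub by blast
    have "(-1) \<odot>\<^bsub>V\<^esub> w \<oplus>\<^bsub>V\<^esub> w = \<zero>\<^bsub>V\<^esub>"
      using V.smult_l_distr[of "-1" 1 w] V.smult_l_null[OF wc] V.smult_one[OF wc] wc by simp
    then have "\<ominus>\<^bsub>V\<^esub> w = (-1) \<odot>\<^bsub>V\<^esub> w"
      using wc V.smult_closed[of "-1" w] by (intro V.M.minus_equality) auto
    then show ?thesis using smult[OF that, of "-1"] by simp
  qed
  have "submodule ?W complex_field V"
    by (rule V.submoduleI[OF sub zero neg add smult])
  then show ?thesis
    unfolding subrepresentation_def using act by blast
qed

lemma irreducible_embeds:
  assumes irr: "irreducible_rep G V"
  shows "\<exists>s :: 'v \<Rightarrow> 'g \<Rightarrow> complex. inj_on s (carrier V)"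
proof -
  from irr obtain v where v: "v \<in> carrier V" "v \<noteq> \<zero>\<^bsub>V\<^esub>"
    unfolding irreducible_rep_def using V.M.zero_closed by blast
  let ?W = "{orbit_sum V v S a | S a. finite S \<and> S \<subseteq> carrier G}"
  have "v = orbit_sum V v {\<one>\<^bsub>G\<^esub>} (\<lambda>_. 1)"
    unfolding orbit_sum_def using v V.smult_one act_one by simp
  then have "v \<in> ?W" by blast
  then have W: "?W = carrier V"
    using irr orbit_span_subrepresentation[OF v(1)] v unfolding irreducible_rep_def by blast
  have "\<forall>w\<in>carrier V. \<exists>a. w = orbit_sum V v {g. a g \<noteq> 0} a"
  proof
    fix w assume "w \<in> carrier V"
    then obtain S a where S: "finite S" "S \<subseteq> carrier G" "w = orbit_sum V v S a"
      using W by blast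
    define b where "b = (\<lambda>g. if g \<in> S then a g else 0)"
    have "orbit_sum V v {g. b g \<noteq> 0} b = orbit_sum V v S b"
      by (rule orbit_sum_mono) (use v S in \<open>auto simp: b_def split: if_splits\<close>)
    also have "\<dots> = w"
      unfolding S(3) by (rule orbit_sum_mono[symmetric]) (use v S in \<open>auto simp: b_def\<close>)
    finally show "\<exists>a. w = orbit_sum V v {g. a g \<noteq> 0} a" by metis
  qed
  then obtain s where s: "\<forall>w\<in>carrier V. w = orbit_sum V v {g. s w g \<noteq> 0} (s w)"
    by metis
  have "inj_on s (carrier V)"
  proof (rule inj_onI)
    fix w x assume wx: "w \<in> carrier V" "x \<in> carrier V" "s w = s x"
    have "w = orbit_sum V v {g. s w g \<noteq> 0} (s w)" using s wx(1) by blast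
    also have "\<dots> = x" unfolding wx(3) using s wx(2) by simp
    finally show "w = x" .
  qed
  then show ?thesis by blast
qed

end

definition transport_rep :: "('v \<Rightarrow> 'w) \<Rightarrow> ('g, 'v) rep \<Rightarrow> ('g, 'w) rep"
  where "transport_rep s V = (let t = the_inv_into (carrier V) s in
    \<lparr>carrier = s ` carrier V, monoid.mult = undefined, one = undefined,
     ring.zero = s \<zero>\<^bsub>V\<^esub>, add = (\<lambda>x y. s (t x \<oplus>\<^bsub>V\<^esub> t y)),
     smult = (\<lambda>c x. s (c \<odot>\<^bsub>V\<^esub> t x)), act = (\<lambda>g x. s (act V g (t x)))\<rparr>)"

lemma transport_rep_simps:
  assumes "inj_on s (carrier V)"
  shows "carrier (transport_rep s V) = s ` carrier V"
    and "\<zero>\<^bsub>transport_rep s V\<^esub> = s \<zero>\<^bsub>V\<^esub>"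
    and "\<lbrakk>v \<in> carrier V; w \<in> carrier V\<rbrakk> \<Longrightarrow> s v \<oplus>\<^bsub>transport_rep s V\<^esub> s w = s (v \<oplus>\<^bsub>V\<^esub> w)"
    and "v \<in> carrier V \<Longrightarrow> c \<odot>\<^bsub>transport_rep s V\<^esub> s v = s (c \<odot>\<^bsub>V\<^esub> v)"
    and "v \<in> carrier V \<Longrightarrow> act (transport_rep s V) g (s v) = s (act V g v)"
  using assms by (simp_all add: transport_rep_def Let_def the_inv_into_f_f)

context representation
begin

lemma representation_transport:
  assumes inj: "inj_on s (carrier V)"
  shows "representation G (transport_rep s V)"
proof -
  note [simp] = transport_rep_simps[OF inj] act_closed
  have smult_closed: "c \<odot>\<^bsub>V\<^esub> v \<in> carrier V" if "v \<in> carrier V" for c v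
    using that by simp
  have ag: "abelian_group (transport_rep s V)"
  proof (rule abelian_groupI)
    fix x assume "x \<in> carrier (transport_rep s V)"
    then obtain v where v: "v \<in> carrier V" "x = s v" by auto
    then show "\<exists>y\<in>carrier (transport_rep s V).
        y \<oplus>\<^bsub>transport_rep s V\<^esub> x = \<zero>\<^bsub>transport_rep s V\<^esub>"
      by (intro bexI[of _ "s (\<ominus>\<^bsub>V\<^esub> v)"]) (auto simp: V.M.l_neg)
  qed (auto simp: V.M.a_ac)
  have "Module.module complex_field (transport_rep s V)"
    by (rule moduleI[OF cring_complex_field ag])
      (use V.smult_l_distr V.smult_r_distr V.smult_assoc1 V.smult_one in auto)
  moreover have "representation_axioms G (transport_rep s V)"
    by unfold_locales (auto simp: act_add act_smult act_one act_mult)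
  ultimately show ?thesis
    by (intro representation.intro G.is_group)
qed

lemma iso_rep_transport:
  assumes inj: "inj_on s (carrier V)"
  shows "iso_rep G V (transport_rep s V)"
  unfolding iso_rep_def Hom_G_def
  using inj by (intro bexI[of _ s]) (auto simp: transport_rep_simps[OF inj] hom_def bij_betw_def)

lemma irreducible_transport:
  assumes inj: "inj_on s (carrier V)" and irr: "irreducible_rep G V"
  shows "irreducible_rep G (transport_rep s V)"
proof -
  interpret W: representation G "transport_rep s V"
    by (rule representation_transport[OF inj])
  note S = transport_rep_simps[OF inj]
  have "s ` carrier V \<noteq> {s \<zero>\<^bsub>V\<^esub>}"
  proof
    assume eq: "s ` carrier V = {s \<zero>\<^bsub>V\<^esub>}"
    have "v = \<zero>\<^bsub>V\<^esub>" if "v \<in> carrier V" for v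
    proof -
      have "s v = s \<zero>\<^bsub>V\<^esub>" using eq that by blast
      then show ?thesis by (rule inj_onD[OF inj]) (use that in auto)
    qed
    then show False
      using irr V.M.zero_closed unfolding irreducible_rep_def by blast
  qed
  moreover have "H = {s \<zero>\<^bsub>V\<^esub>} \<or> H = s ` carrier V"
    if H: "subrepresentation G (transport_rep s V) H" for H
  proof -
    have sm: "submodule H complex_field (transport_rep s V)"
      and stable: "\<And>g x. \<lbrakk>g \<in> carrier G; x \<in> H\<rbrakk> \<Longrightarrow> act (transport_rep s V) g x \<in> H"
      using H unfolding subrepresentation_def by auto
    note E = W.V.submoduleE[OF sm]
    define U where "U = {v \<in> carrier V. s v \<in> H}"
    have HU: "H = s ` U" using E(1) S(1) unfolding U_def by auto
    have zero: "s \<zero>\<^bsub>V\<^esub> \<in> H"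
    proof -
      obtain x where x: "x \<in> H" using E(2) by blast
      then have "0 \<odot>\<^bsub>transport_rep s V\<^esub> x \<in> H" using E(4) by simp
      moreover have "x \<in> carrier (transport_rep s V)" using x E(1) by blast
      ultimately show ?thesis using W.V.smult_l_null[of x] S(2) by simp
    qed
    have "submodule U complex_field V"
    proof (rule V.submoduleI)
      fix v assume v: "v \<in> U"
      have "(-1) \<odot>\<^bsub>V\<^esub> v \<oplus>\<^bsub>V\<^esub> v = \<zero>\<^bsub>V\<^esub>"
        using V.smult_l_distr[of "-1" 1 v] V.smult_l_null[of v] V.smult_one[of v] v
        by (simp add: U_def)
      then have "\<ominus>\<^bsub>V\<^esub> v = (-1) \<odot>\<^bsub>V\<^esub> v"
        using v by (intro V.M.minus_equality) (auto simp: U_def)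
      then show "\<ominus>\<^bsub>V\<^esub> v \<in> U"
        using v E(4)[of "-1" "s v"] by (auto simp: U_def S)
    next
      fix v w assume "v \<in> U" "w \<in> U"
      then show "v \<oplus>\<^bsub>V\<^esub> w \<in> U" using E(5)[of "s v" "s w"] by (auto simp: U_def S)
    next
      fix c v assume "v \<in> U"
      then show "c \<odot>\<^bsub>V\<^esub> v \<in> U" using E(4)[of c "s v"] by (auto simp: U_def S)
    qed (use zero in \<open>auto simp: U_def\<close>)
    moreover have "act V g v \<in> U" if "g \<in> carrier G" "v \<in> U" for g v
      using stable[of g "s v"] that by (auto simp: U_def S act_closed)
    ultimately have "subrepresentation G V U"
      unfolding subrepresentation_def by blast
    then have "U = {\<zero>\<^bsub>V\<^esub>} \<or> U = carrier V"
      using irr unfolding irreducible_rep_def by blast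
    then show ?thesis unfolding HU by auto
  qed
  ultimately show ?thesis
    unfolding irreducible_rep_def S using W.representation_axioms by blast
qed

end

lemma smooth_transport:
  assumes inj: "inj_on s (carrier V)" and smooth: "smooth_rep G T V"
  shows "smooth_rep G T (transport_rep s V)"
proof -
  interpret representation G V using smooth unfolding smooth_rep_def by blast
  have "stabilizer_of G (transport_rep s V) (s v) = stabilizer_of G V v"
    if "v \<in> carrier V" for v
    using that inj
    by (auto simp: stabilizer_of_def transport_rep_simps[OF inj] act_closed inj_on_eq_iff)
  then show ?thesis
    using smooth representation_transport[OF inj]
    by (auto simp: smooth_rep_def transport_rep_simps(1)[OF inj])
qed

lemma irreducible_smooth_has_std_copy:
  assumes "irreducible_smooth G T V"
  shows "\<exists>W :: 'g std_rep. irreducible_smooth G T W \<and> iso_rep G V W"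
proof -
  have rep: "representation G V"
    using assms unfolding irreducible_smooth_def irreducible_rep_def by blast
  interpret representation G V by (rule rep)
  obtain s :: "_ \<Rightarrow> 'g \<Rightarrow> complex" where s: "inj_on s (carrier V)"
    using irreducible_embeds assms unfolding irreducible_smooth_def by blast
  show ?thesis
    using assms irreducible_transport[OF s] smooth_transport[OF s] iso_rep_transport[OF s]
    unfolding irreducible_smooth_def by blast
qed

lemma iso_rep_trans:
  assumes "iso_rep G U V" "iso_rep G V W"
  shows "iso_rep G U W"
proof -
  obtain f where f: "f \<in> Hom_G G U V" "bij_betw f (carrier U) (carrier V)"
    using assms(1) unfolding iso_rep_def by blast
  obtain h where h: "h \<in> Hom_G G V W" "bij_betw h (carrier V) (carrier W)"
    using assms(2) unfolding iso_rep_def by blast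
  have "h \<circ> f \<in> Hom_G G U W"
    using f(1) h(1) by (auto simp: Hom_G_def hom_def Pi_iff)
  then show ?thesis
    unfolding iso_rep_def using bij_betw_trans[OF f(2) h(2)] by blast
qed

lemma iso_rep_sym:
  assumes iso: "iso_rep G V W" and V: "representation G V"
  shows "iso_rep G W V"
proof -
  interpret representation G V by (rule V)
  obtain f where f: "f \<in> Hom_G G V W" "bij_betw f (carrier V) (carrier W)"
    using iso unfolding iso_rep_def by blast
  define k where "k = inv_into (carrier V) f"
  have inj: "inj_on f (carrier V)" and im: "carrier W = f ` carrier V"
    using f(2) by (auto simp: bij_betw_def)
  have kf: "k (f v) = v" if "v \<in> carrier V" for v
    unfolding k_def using inj that by (rule inv_into_f_f)
  have fadd: "f v \<oplus>\<^bsub>W\<^esub> f w = f (v \<oplus>\<^bsub>V\<^esub> w)" if "v \<in> carrier V" "w \<in> carrier V" for v w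
    using f(1) that by (auto simp: Hom_G_def hom_def)
  have fsmult: "c \<odot>\<^bsub>W\<^esub> f v = f (c \<odot>\<^bsub>V\<^esub> v)" if "v \<in> carrier V" for c v
    using f(1) that by (auto simp: Hom_G_def)
  have fact': "act W g (f v) = f (act V g v)" if "v \<in> carrier V" "g \<in> carrier G" for g v
    using f(1) that by (auto simp: Hom_G_def)
  have "k \<in> Hom_G G W V"
    unfolding Hom_G_def hom_def
    by (auto simp: im kf fadd fsmult fact' act_closed)
  moreover have "bij_betw k (carrier W) (carrier V)"
    unfolding k_def by (rule bij_betw_inv_into[OF f(2)])
  ultimately show ?thesis unfolding iso_rep_def by blast
qed

lemma irr_class_in_irr_classes:
  fixes V :: "('g, 'v) rep"
  assumes V: "irreducible_smooth G T V"
  shows "irr_class G T V \<in> irr_classes G T"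
proof -
  obtain W :: "'g std_rep" where W: "irreducible_smooth G T W" "iso_rep G V W"
    using irreducible_smooth_has_std_copy[OF V] by blast
  have "representation G V"
    using V by (simp add: irreducible_smooth_def irreducible_rep_def)
  then have "iso_rep G W V" using iso_rep_sym[OF W(2)] by blast
  then have "irr_class G T V = irr_class G T W"
    unfolding irr_class_def using iso_rep_trans[OF W(2)] iso_rep_trans[of G W V] by blast
  then show ?thesis
    unfolding irr_classes_def using W(1) by blast
qed

end

theory Submission
  imports Defs "HOL-Library.Function_Algebras"
begin

text \<open>
  Let \<open>f\<close> be a morphism from \<open>M\<close> to an irreducible \<open>R\<close> that kills every vector killed by all of
  \<open>Hom_G G M P\<close>, and suppose \<open>f m \<noteq> 0\<close>. The vector \<open>m\<close> is fixed by a compact open subgroup \<open>K\<close>, so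
  the values \<open>p m\<close> for \<open>p \<in> Hom_G G M P\<close> lie in the finite-dimensional space of \<open>K\<close>-fixed vectors
  of \<open>P\<close> and are spanned by finitely many of them, say \<open>p\<^sub>1 m, \<dots>, p\<^sub>n m\<close>. On the
  subrepresentation generated by \<open>m\<close>, the common kernel of \<open>p\<^sub>1, \<dots>, p\<^sub>n\<close> is then the common kernel
  of all of \<open>Hom_G G M P\<close>, hence is contained in the kernel of \<open>f\<close>. So a subquotient of \<open>P\<^sup>n\<close> maps
  onto \<open>R\<close>, and \<open>R\<close> is isomorphic to \<open>P\<close>.
\<close>

section \<open>Submodules over the complex numbers and linearity of orbit sums\<close>

context representation
begin

lemma neg_eq_smult:
  assumes "v \<in> carrier V"
  shows "\<ominus>\<^bsub>V\<^esub> v = (-1) \<odot>\<^bsub>V\<^esub> v"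
proof -
  have "(-1) \<odot>\<^bsub>V\<^esub> v \<oplus>\<^bsub>V\<^esub> v = \<zero>\<^bsub>V\<^esub>"
    using V.smult_l_distr[of "-1" 1 v] V.smult_l_null[OF assms] V.smult_one[OF assms] assms by simp
  then show ?thesis
    using assms V.smult_closed[of "-1" v] by (intro V.M.minus_equality) auto
qed

text \<open>Negation is scaling by -1, so over the complex numbers closure under it need not be
  checked separately.\<close>

lemma submodule_complexI:
  assumes "U \<subseteq> carrier V" "\<zero>\<^bsub>V\<^esub> \<in> U"
    and "\<And>v w. \<lbrakk>v \<in> U; w \<in> U\<rbrakk> \<Longrightarrow> v \<oplus>\<^bsub>V\<^esub> w \<in> U"
    and "\<And>c v. v \<in> U \<Longrightarrow> c \<odot>\<^bsub>V\<^esub> v \<in> U"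
  shows "submodule U complex_field V"
  by (rule V.submoduleI) (use assms neg_eq_smult in auto)

lemma submoduleD:
  assumes U: "submodule U complex_field V"
  shows "U \<subseteq> carrier V" "\<zero>\<^bsub>V\<^esub> \<in> U"
    and "\<And>v w. \<lbrakk>v \<in> U; w \<in> U\<rbrakk> \<Longrightarrow> v \<oplus>\<^bsub>V\<^esub> w \<in> U"
    and "\<And>c v. v \<in> U \<Longrightarrow> c \<odot>\<^bsub>V\<^esub> v \<in> U"
proof -
  note E = V.submoduleE[OF U]
  show sub: "U \<subseteq> carrier V" by (rule E(1))
  obtain u where u: "u \<in> U" using E(2) by blast
  then show "\<zero>\<^bsub>V\<^esub> \<in> U"
    using E(4)[of 0 u] V.smult_l_null[of u] sub by auto
qed (use V.submoduleE[OF U] in auto)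

lemma subrepresentation_carrier: "subrepresentation G V (carrier V)"
  unfolding subrepresentation_def by (auto intro!: submodule_complexI act_closed)

lemma orbit_sum_zero:
  assumes "S \<subseteq> carrier G"
  shows "orbit_sum V \<zero>\<^bsub>V\<^esub> S a = \<zero>\<^bsub>V\<^esub>"
proof -
  have "orbit_sum V \<zero>\<^bsub>V\<^esub> S a = (\<Oplus>\<^bsub>V\<^esub>g\<in>S. \<zero>\<^bsub>V\<^esub>)"
    unfolding orbit_sum_def using assms
    by (intro V.M.finsum_cong') (auto simp: act_zero V.smult_r_null subset_iff)
  then show ?thesis by simp
qed

lemma orbit_sum_add:
  assumes "S \<subseteq> carrier G" "v \<in> carrier V" "w \<in> carrier V"
  shows "orbit_sum V (v \<oplus>\<^bsub>V\<^esub> w) S a = orbit_sum V v S a \<oplus>\<^bsub>V\<^esub> orbit_sum V w S a"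
proof -
  have [simp]: "g \<in> carrier G" if "g \<in> S" for g using that assms by blast
  have "orbit_sum V (v \<oplus>\<^bsub>V\<^esub> w) S a =
      (\<Oplus>\<^bsub>V\<^esub>g\<in>S. a g \<odot>\<^bsub>V\<^esub> act V g v \<oplus>\<^bsub>V\<^esub> a g \<odot>\<^bsub>V\<^esub> act V g w)"
    unfolding orbit_sum_def using assms
    by (intro V.M.finsum_cong') (auto simp: act_add act_closed V.smult_r_distr)
  also have "\<dots> = orbit_sum V v S a \<oplus>\<^bsub>V\<^esub> orbit_sum V w S a"
    unfolding orbit_sum_def using assms
    by (intro V.M.finsum_addf) (auto simp: act_closed)
  finally show ?thesis .
qed

lemma orbit_sum_smult:
  assumes "finite S" "S \<subseteq> carrier G" "v \<in> carrier V"
  shows "orbit_sum V (c \<odot>\<^bsub>V\<^esub> v) S a = c \<odot>\<^bsub>V\<^esub> orbit_sum V v S a"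
proof -
  have [simp]: "g \<in> carrier G" if "g \<in> S" for g using that assms by blast
  have "a g \<odot>\<^bsub>V\<^esub> (c \<odot>\<^bsub>V\<^esub> x) = c \<odot>\<^bsub>V\<^esub> (a g \<odot>\<^bsub>V\<^esub> x)" if "x \<in> carrier V" for g x
    using V.smult_assoc1[of "a g" c x] V.smult_assoc1[of c "a g" x] that
    by (simp add: mult.commute)
  then have "orbit_sum V (c \<odot>\<^bsub>V\<^esub> v) S a = (\<Oplus>\<^bsub>V\<^esub>g\<in>S. c \<odot>\<^bsub>V\<^esub> (a g \<odot>\<^bsub>V\<^esub> act V g v))"
    unfolding orbit_sum_def using assms
    by (intro V.M.finsum_cong') (auto simp: act_smult act_closed)
  also have "\<dots> = c \<odot>\<^bsub>V\<^esub> orbit_sum V v S a"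
    unfolding orbit_sum_def using assms
    by (intro V.finsum_smult_ldistr[symmetric]) (auto simp: act_closed)
  finally show ?thesis .
qed

text \<open>With \<open>S\<close> and \<open>a\<close> fixed, \<open>orbit_sum V v S a\<close> is
  the result of applying one element of the group algebra to \<open>v\<close>. This is linear in
  \<open>v\<close> but in general not equivariant, so the kernel is claimed to be a submodule only.
  Through it a relation that holds for a few vectors passes to everything they span.\<close>

lemma orbit_sum_kernel_submodule:
  assumes "finite S" "S \<subseteq> carrier G"
  shows "submodule {v \<in> carrier V. orbit_sum V v S a = \<zero>\<^bsub>V\<^esub>} complex_field V"
  by (rule submodule_complexI)
    (use assms in \<open>auto simp: orbit_sum_zero orbit_sum_add orbit_sum_smult V.smult_r_null\<close>)

text \<open>A subset of a finite-dimensional space has the same span as some finite part of it. The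
  span is encoded by quantifying over the submodules that contain it; \<open>Y\<close> itself need
  not be closed under anything.\<close>

lemma finite_dim_subset_generated:
  assumes A: "finite_dim V A" "A \<subseteq> carrier V" and Y: "Y \<subseteq> A"
  shows "\<exists>F. finite F \<and> F \<subseteq> Y \<and> (\<forall>U. submodule U complex_field V \<and> F \<subseteq> U \<longrightarrow> Y \<subseteq> U)"
proof -
  obtain B where B: "finite B" "B \<subseteq> A"
    and span: "\<forall>w\<in>A. \<exists>c :: 'v \<Rightarrow> complex. w = (\<Oplus>\<^bsub>V\<^esub>b\<in>B. c b \<odot>\<^bsub>V\<^esub> b)"
    using A(1) unfolding finite_dim_def by blast
  have BV: "b \<in> carrier V" if "b \<in> B" for b using that B A by blast
  \<comment> \<open>\<open>Vector_Spaces\<close> needs a full type as vector space, so independence is used for coordinate functions.\<close>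
  define comb where "comb c = (\<Oplus>\<^bsub>V\<^esub>b\<in>B. c b \<odot>\<^bsub>V\<^esub> b)" for c :: "'v \<Rightarrow> complex"
  have comb_closed: "comb c \<in> carrier V" for c
    unfolding comb_def by (intro V.M.finsum_closed) (auto simp: BV)
  have comb_zero: "comb 0 = \<zero>\<^bsub>V\<^esub>"
  proof -
    have "comb 0 = (\<Oplus>\<^bsub>V\<^esub>b\<in>B. \<zero>\<^bsub>V\<^esub>)"
      unfolding comb_def using V.smult_l_null BV by (intro V.M.finsum_cong') auto
    then show ?thesis by simp
  qed
  have comb_add: "comb (c + d) = comb c \<oplus>\<^bsub>V\<^esub> comb d" for c d
  proof -
    have "comb (c + d) = (\<Oplus>\<^bsub>V\<^esub>b\<in>B. c b \<odot>\<^bsub>V\<^esub> b \<oplus>\<^bsub>V\<^esub> d b \<odot>\<^bsub>V\<^esub> b)"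
      unfolding comb_def using V.smult_l_distr BV by (intro V.M.finsum_cong') auto
    then show ?thesis
      unfolding comb_def using BV by (subst V.M.finsum_addf[symmetric]) auto
  qed
  have comb_smult: "comb (\<lambda>b. k * c b) = k \<odot>\<^bsub>V\<^esub> comb c" for k c
  proof -
    have "comb (\<lambda>b. k * c b) = (\<Oplus>\<^bsub>V\<^esub>b\<in>B. k \<odot>\<^bsub>V\<^esub> (c b \<odot>\<^bsub>V\<^esub> b))"
      unfolding comb_def using V.smult_assoc1 BV by (intro V.M.finsum_cong') auto
    then show ?thesis
      unfolding comb_def using BV B by (subst V.finsum_smult_ldistr) auto
  qed
  interpret fn: vector_space "\<lambda>(k::complex) (c::'v \<Rightarrow> complex) b. k * c b"
    by unfold_locales (auto simp: fun_eq_iff algebra_simps)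
  define \<delta> where "\<delta> x = (\<lambda>b. if b = x then 1 else 0 :: complex)" for x :: 'v
  have supported: "c \<in> fn.span (\<delta> ` E)" if "finite E" "\<And>b. b \<notin> E \<Longrightarrow> c b = 0" for E c
    using that
  proof (induction E arbitrary: c)
    case empty
    then have "c = 0" by (auto simp: fun_eq_iff)
    then show ?case using fn.span_zero by metis
  next
    case (insert x E)
    have "c(x := 0) \<in> fn.span (\<delta> ` E)" by (rule insert.IH) (use insert.prems in auto)
    then have "c(x := 0) \<in> fn.span (\<delta> ` insert x E)"
      using fn.span_mono[of "\<delta> ` E" "\<delta> ` insert x E"] by blast
    moreover have "(\<lambda>b. c x * \<delta> x b) \<in> fn.span (\<delta> ` insert x E)"
      by (intro fn.span_scale fn.span_base) auto
    moreover have "c = c(x := 0) + (\<lambda>b. c x * \<delta> x b)"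
      by (auto simp: fun_eq_iff \<delta>_def)
    ultimately show ?case by (metis fn.span_add)
  qed
  \<comment> \<open>Coefficients are set to zero outside \<open>B\<close>; otherwise the coordinate
    functions could range over an infinite-dimensional space.\<close>
  have "\<exists>c. y = comb c \<and> (\<forall>b. b \<notin> B \<longrightarrow> c b = 0)" if y: "y \<in> Y" for y
  proof -
    obtain c where c: "y = comb c" using span y Y unfolding comb_def by blast
    have "comb (\<lambda>b. if b \<in> B then c b else 0) = comb c"
      unfolding comb_def using BV by (intro V.M.finsum_cong') auto
    then show ?thesis using c by (intro exI[of _ "\<lambda>b. if b \<in> B then c b else 0"]) auto
  qed
  then obtain coord where coord: "\<And>y. y \<in> Y \<Longrightarrow> y = comb (coord y)"
    and coord_supp: "\<And>y b. \<lbrakk>y \<in> Y; b \<notin> B\<rbrakk> \<Longrightarrow> coord y b = 0"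
    by metis
  \<comment> \<open>Coordinates supported on \<open>B\<close> lie in the span of finitely many delta
    functions, so a maximal independent set \<open>D\<close> among them is finite. Choosing one
    preimage in \<open>Y\<close> for each element of \<open>D\<close> gives
    \<open>F\<close>.\<close>
  obtain D where D: "D \<subseteq> coord ` Y" "fn.independent D" "coord ` Y \<subseteq> fn.span D"
    by (rule fn.maximal_independent_subset)
  have "D \<subseteq> fn.span (\<delta> ` B)" using D(1) coord_supp supported[OF B(1)] by blast
  then have "finite D" using fn.independent_span_bound[OF _ D(2)] B(1) by blast
  then obtain F where F: "F \<subseteq> Y" "finite F" "D = coord ` F"
    using finite_subset_image[OF _ D(1)] by blast
  have "Y \<subseteq> U" if U: "submodule U complex_field V" "F \<subseteq> U" for U
  proof -
    \<comment> \<open>As \<open>comb\<close> is linear, \<open>U\<close> pulls back to a subspace of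
      coordinate functions. It contains \<open>D\<close>, hence all coordinates of
      \<open>Y\<close>.\<close>
    have "fn.subspace {c. comb c \<in> U}"
      using submoduleD[OF U(1)]
      by (auto simp: fn.subspace_def comb_zero comb_add comb_smult)
    moreover have "D \<subseteq> {c. comb c \<in> U}"
      using F(1,3) U(2) coord by fastforce
    ultimately have "fn.span D \<subseteq> {c. comb c \<in> U}" by (intro fn.span_minimal)
    then have "comb (coord y) \<in> U" if "y \<in> Y" for y using D(3) that by blast
    then show ?thesis using coord by fastforce
  qed
  then show ?thesis using F by blast
qed

end

section \<open>Intertwining maps, their images and kernels\<close>

locale intertwiner = V: representation G V + W: representation G W
  for G :: "('g, 'b) monoid_scheme" and V :: "('g, 'v) rep" and W :: "('g, 'w) rep" +
  fixes f :: "'v \<Rightarrow> 'w"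
  assumes Hom: "f \<in> Hom_G G V W"
begin

lemma closed: "v \<in> carrier V \<Longrightarrow> f v \<in> carrier W"
  using Hom by (auto simp: Hom_G_def hom_def)

lemma add: "\<lbrakk>v \<in> carrier V; w \<in> carrier V\<rbrakk> \<Longrightarrow> f (v \<oplus>\<^bsub>V\<^esub> w) = f v \<oplus>\<^bsub>W\<^esub> f w"
  using Hom by (auto simp: Hom_G_def hom_def)

lemma smult: "v \<in> carrier V \<Longrightarrow> f (c \<odot>\<^bsub>V\<^esub> v) = c \<odot>\<^bsub>W\<^esub> f v"
  using Hom by (auto simp: Hom_G_def)

lemma equivariant: "\<lbrakk>g \<in> carrier G; v \<in> carrier V\<rbrakk> \<Longrightarrow> f (act V g v) = act W g (f v)"
  using Hom by (auto simp: Hom_G_def)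

lemma zero: "f \<zero>\<^bsub>V\<^esub> = \<zero>\<^bsub>W\<^esub>"
  using smult[of "\<zero>\<^bsub>V\<^esub>" 0] V.V.smult_l_null[of "\<zero>\<^bsub>V\<^esub>"] W.V.smult_l_null[of "f \<zero>\<^bsub>V\<^esub>"] closed
  by simp

lemma diff: "\<lbrakk>v \<in> carrier V; w \<in> carrier V\<rbrakk> \<Longrightarrow> f (v \<ominus>\<^bsub>V\<^esub> w) = f v \<ominus>\<^bsub>W\<^esub> f w"
  by (simp add: a_minus_def V.neg_eq_smult W.neg_eq_smult closed add smult)

lemma diff_eq_zero_iff:
  assumes "v \<in> carrier V" "w \<in> carrier V"
  shows "f (v \<ominus>\<^bsub>V\<^esub> w) = \<zero>\<^bsub>W\<^esub> \<longleftrightarrow> f v = f w"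
proof -
  have fv: "f v \<in> carrier W" and fw: "f w \<in> carrier W" using assms by (auto intro: closed)
  have "f v \<ominus>\<^bsub>W\<^esub> f w \<oplus>\<^bsub>W\<^esub> f w = f v"
    using fv fw by (simp add: a_minus_def W.V.M.a_assoc W.V.M.l_neg)
  moreover have "f w \<ominus>\<^bsub>W\<^esub> f w = \<zero>\<^bsub>W\<^esub>"
    using fw by (simp add: a_minus_def W.V.M.r_neg)
  ultimately show ?thesis
    using assms fw by (auto simp: diff)
qed

lemma orbit_sum:
  assumes "finite S" "S \<subseteq> carrier G" "v \<in> carrier V"
  shows "f (orbit_sum V v S a) = orbit_sum W (f v) S a"
  using assms
proof (induction S)
  case empty
  then show ?case by (simp add: orbit_sum_def zero)
next
  case (insert g S)
  then have g: "g \<in> carrier G" "S \<subseteq> carrier G" by auto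
  have "orbit_sum V v (insert g S) a = a g \<odot>\<^bsub>V\<^esub> act V g v \<oplus>\<^bsub>V\<^esub> orbit_sum V v S a"
    unfolding orbit_sum_def using insert g
    by (intro V.V.M.finsum_insert) (auto intro!: V.act_closed)
  moreover have "orbit_sum W (f v) (insert g S) a
      = a g \<odot>\<^bsub>W\<^esub> act W g (f v) \<oplus>\<^bsub>W\<^esub> orbit_sum W (f v) S a"
    unfolding orbit_sum_def using insert g
    by (intro W.V.M.finsum_insert) (auto intro!: W.act_closed closed)
  ultimately show ?case
    using insert g
    by (simp add: add smult equivariant V.act_closed V.orbit_sum_closed)
qed

lemma image_subrepresentation:
  assumes "subrepresentation G V U"
  shows "subrepresentation G W (f ` U)"
proof -
  have U: "submodule U complex_field V" and act: "\<And>g u. \<lbrakk>g \<in> carrier G; u \<in> U\<rbrakk> \<Longrightarrow> act V g u \<in> U"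
    using assms unfolding subrepresentation_def by auto
  note D = V.submoduleD[OF U]
  have "submodule (f ` U) complex_field W"
  proof (rule W.submodule_complexI)
    show "f ` U \<subseteq> carrier W" using D(1) closed by blast
    show "\<zero>\<^bsub>W\<^esub> \<in> f ` U" using D(2) zero by (metis image_eqI)
  next
    fix v w assume "v \<in> f ` U" "w \<in> f ` U"
    then obtain x y where "x \<in> U" "y \<in> U" "v = f x" "w = f y" by blast
    then show "v \<oplus>\<^bsub>W\<^esub> w \<in> f ` U" using D(1) D(3)[of x y] add[of x y] by (metis image_eqI subsetD)
  next
    fix c v assume "v \<in> f ` U"
    then obtain x where "x \<in> U" "v = f x" by blast
    then show "c \<odot>\<^bsub>W\<^esub> v \<in> f ` U" using D(1) D(4)[of x c] smult[of x c] by (metis image_eqI subsetD)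
  qed
  moreover have "act W g (f u) \<in> f ` U" if "g \<in> carrier G" "u \<in> U" for g u
    using that act[of g u] equivariant[of g u] D(1) by (metis image_eqI subsetD)
  ultimately show ?thesis unfolding subrepresentation_def by blast
qed

text \<open>The kernel is taken inside a subrepresentation \<open>U\<close>, so that the kernels of
  several maps can be cut out one after another.\<close>

lemma kernel_subrepresentation:
  assumes "subrepresentation G V U"
  shows "subrepresentation G V {u \<in> U. f u = \<zero>\<^bsub>W\<^esub>}"
proof -
  have U: "submodule U complex_field V" and act: "\<And>g u. \<lbrakk>g \<in> carrier G; u \<in> U\<rbrakk> \<Longrightarrow> act V g u \<in> U"
    using assms unfolding subrepresentation_def by auto
  note D = V.submoduleD[OF U]
  have C: "u \<in> carrier V" if "u \<in> U" for u using that D(1) by blast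
  show ?thesis
    unfolding subrepresentation_def
    by (auto intro!: V.submodule_complexI
        simp: D(2-) C act zero add smult equivariant W.V.smult_r_null W.act_zero)
qed

end

section \<open>Schur-type comparison of two irreducible representations\<close>

lemma irreducible_image:
  assumes "irreducible_rep G P" "f \<in> Hom_G G M P" "representation G M"
    and "subrepresentation G M W" "w \<in> W" "f w \<noteq> \<zero>\<^bsub>P\<^esub>"
  shows "f ` W = carrier P"
proof -
  interpret intertwiner G M P f
    using assms by (simp add: intertwiner_def intertwiner_axioms_def irreducible_rep_def)
  show ?thesis
    using image_subrepresentation[OF assms(4)] assms(1,5,6) unfolding irreducible_rep_def by blast
qed

text \<open>On \<open>W\<close> the map \<open>f\<close> factors through \<open>p\<close>, giving
  \<open>h\<close> from \<open>P\<close> to \<open>R\<close>. It is onto because \<open>f\<close>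
  maps \<open>W\<close> onto \<open>R\<close>, and injective because its kernel is a proper
  subrepresentation of the irreducible \<open>P\<close>.\<close>

lemma iso_rep_of_kernel_le:
  assumes P: "irreducible_rep G P" and R: "irreducible_rep G R" and M: "representation G M"
    and p: "p \<in> Hom_G G M P" and f: "f \<in> Hom_G G M R" and W: "subrepresentation G M W"
    and le: "\<And>w. \<lbrakk>w \<in> W; p w = \<zero>\<^bsub>P\<^esub>\<rbrakk> \<Longrightarrow> f w = \<zero>\<^bsub>R\<^esub>"
    and w0: "w\<^sub>0 \<in> W" "f w\<^sub>0 \<noteq> \<zero>\<^bsub>R\<^esub>"
  shows "iso_rep G P R"
proof -
  interpret p: intertwiner G M P p
    using M p P by (simp add: intertwiner_def intertwiner_axioms_def irreducible_rep_def)
  interpret f: intertwiner G M R f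
    using M f R by (simp add: intertwiner_def intertwiner_axioms_def irreducible_rep_def)
  have Wm: "submodule W complex_field M"
    and act: "\<And>g u. \<lbrakk>g \<in> carrier G; u \<in> W\<rbrakk> \<Longrightarrow> act M g u \<in> W"
    using W unfolding subrepresentation_def by auto
  note D = p.V.submoduleD[OF Wm]
  have C: "w \<in> carrier M" if "w \<in> W" for w using that D(1) by blast
  have diffW: "v \<ominus>\<^bsub>M\<^esub> w \<in> W" if "v \<in> W" "w \<in> W" for v w
    using that D(3,4) by (simp add: a_minus_def p.V.neg_eq_smult C)
  \<comment> \<open>If \<open>p\<close> vanished at \<open>w\<^sub>0\<close>, so would
    \<open>f\<close>; thus \<open>p\<close> is nonzero on \<open>W\<close>.\<close>
  have pW: "p ` W = carrier P"
    using irreducible_image[OF P p M W w0(1)] le[OF w0(1)] w0(2) by blast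
  have fW: "f ` W = carrier R"
    using irreducible_image[OF R f M W w0(1,2)] .
  define h where "h x = f (inv_into W p x)" for x
  \<comment> \<open>The choice of preimage in \<open>h\<close> is harmless: the chosen preimage of
    \<open>p w\<close> differs from \<open>w\<close> by an element of \<open>W\<close> killed by
    \<open>p\<close>, hence by \<open>f\<close>.\<close>
  have hp: "h (p w) = f w" if w: "w \<in> W" for w
  proof -
    let ?v = "inv_into W p (p w)"
    have v: "?v \<in> W" "p ?v = p w" using w by (auto intro: inv_into_into f_inv_into_f)
    then have "f (?v \<ominus>\<^bsub>M\<^esub> w) = \<zero>\<^bsub>R\<^esub>"
      using le[OF diffW[OF v(1) w]] p.diff_eq_zero_iff[of ?v w] C w by blast
    then show ?thesis
      unfolding h_def using f.diff_eq_zero_iff[of ?v w] C w v by blast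
  qed
  have "h \<in> Hom_G G P R"
    unfolding Hom_G_def hom_def pW[symmetric]
    by (auto simp: hp C D act f.closed p.add[symmetric] f.add[symmetric] p.smult[symmetric]
        f.smult[symmetric] p.equivariant[symmetric] f.equivariant[symmetric])
  moreover have "h ` carrier P = carrier R"
    unfolding pW[symmetric] fW[symmetric] by (auto simp: hp image_image)
  moreover have "inj_on h (carrier P)"
  proof -
    have sub: "subrepresentation G P (p ` {w \<in> W. f w = \<zero>\<^bsub>R\<^esub>})"
      by (intro p.image_subrepresentation f.kernel_subrepresentation W)
    \<comment> \<open>This image is the kernel of \<open>h\<close>. Missing
      \<open>p w\<^sub>0\<close>, it is not all of \<open>P\<close>, so irreducibility leaves only
      zero.\<close>
    have "p w\<^sub>0 \<notin> p ` {w \<in> W. f w = \<zero>\<^bsub>R\<^esub>}"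
    proof
      assume "p w\<^sub>0 \<in> p ` {w \<in> W. f w = \<zero>\<^bsub>R\<^esub>}"
      then obtain w where w: "w \<in> W" "f w = \<zero>\<^bsub>R\<^esub>" "p w\<^sub>0 = p w" by blast
      show False using hp[OF w(1)] hp[OF w0(1)] w w0(2) by simp
    qed
    then have "p ` {w \<in> W. f w = \<zero>\<^bsub>R\<^esub>} = {\<zero>\<^bsub>P\<^esub>}"
      using sub P w0(1) pW unfolding irreducible_rep_def by blast
    then have ker: "p w = \<zero>\<^bsub>P\<^esub>" if "w \<in> W" "f w = \<zero>\<^bsub>R\<^esub>" for w using that by blast
    have "inj_on h (p ` W)"
    proof (rule inj_onI, elim imageE)
      fix x y v w assume *: "h x = h y" "x = p v" "y = p w" "v \<in> W" "w \<in> W"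
      then have "f v = f w" using hp by metis
      then show "x = y"
        using ker[OF diffW[OF *(4,5)]] p.diff_eq_zero_iff[OF C C, OF *(4,5)]
          f.diff_eq_zero_iff[OF C C, OF *(4,5)] *(2,3)
        by simp
    qed
    then show ?thesis by (simp add: pW)
  qed
  ultimately show ?thesis
    unfolding iso_rep_def bij_betw_def by blast
qed

text \<open>Induction on \<open>F\<close> takes the place of a composition series of a finite power
  of \<open>P\<close>. For \<open>p\<close> in \<open>F\<close>, either \<open>f\<close> is nonzero
  on the part of \<open>W\<close> killed by \<open>p\<close>, and the remaining maps suffice there,
  or \<open>f\<close> vanishes on that part and \<open>p\<close> alone controls \<open>f\<close> on
  \<open>W\<close>. For empty \<open>F\<close> the kernel condition makes \<open>f\<close> zero on
  \<open>W\<close>, a contradiction.\<close>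

lemma iso_rep_of_finite_kernel_le:
  assumes P: "irreducible_rep G P" and R: "irreducible_rep G R" and M: "representation G M"
    and "finite F" "F \<subseteq> Hom_G G M P" and f: "f \<in> Hom_G G M R"
    and "subrepresentation G M W"
    and "\<And>w. \<lbrakk>w \<in> W; \<forall>p\<in>F. p w = \<zero>\<^bsub>P\<^esub>\<rbrakk> \<Longrightarrow> f w = \<zero>\<^bsub>R\<^esub>"
    and "\<exists>w\<in>W. f w \<noteq> \<zero>\<^bsub>R\<^esub>"
  shows "iso_rep G P R"
  using assms(4,5,7-)
proof (induction F arbitrary: W)
  case empty
  then show ?case by blast
next
  case (insert p F)
  interpret p: intertwiner G M P p
    using M P insert.prems(1)
    by (simp add: intertwiner_def intertwiner_axioms_def irreducible_rep_def)
  let ?W' = "{w \<in> W. p w = \<zero>\<^bsub>P\<^esub>}"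
  show ?case
  proof (cases "\<exists>w\<in>?W'. f w \<noteq> \<zero>\<^bsub>R\<^esub>")
    case True
    show ?thesis
      by (rule insert.IH[of ?W'])
        (use insert.prems True in \<open>auto intro: p.kernel_subrepresentation\<close>)
  next
    case False
    then show ?thesis
      using iso_rep_of_kernel_le[OF P R M p.Hom f insert.prems(2)] insert.prems(4) by blast
  qed
qed

section \<open>Independence of the representative of an isomorphism class\<close>

lemma comp_Hom_G:
  assumes "f \<in> Hom_G G U V" "h \<in> Hom_G G V W"
  shows "h \<circ> f \<in> Hom_G G U W"
  using assms by (auto simp: Hom_G_def hom_def Pi_iff)

text \<open>Composing with an isomorphism from \<open>P\<close> to \<open>P'\<close> does not change
  kernels, so the same subspace of \<open>M\<close> is divided out and the two quotients are equal,
  not merely isomorphic.\<close>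

lemma isotypic_quotient_cong:
  assumes M: "representation G M" and P: "representation G P" and P': "representation G P'"
    and iso: "iso_rep G P P'"
  shows "isotypic_quotient G M P = isotypic_quotient G M P'"
proof -
  \<comment> \<open>Arbitrary \<open>Q\<close> and \<open>Q'\<close> are needed because the
    inclusion is used in both directions and \<open>P\<close>, \<open>P'\<close> have different
    carrier types.\<close>
  have le: "(\<Inter>f\<in>Hom_G G M Q'. a_kernel M Q' f) \<subseteq> (\<Inter>f\<in>Hom_G G M Q. a_kernel M Q f)"
    if Q: "representation G Q" and Q': "representation G Q'" and iso: "iso_rep G Q Q'"
    for Q :: "('a, 'u) rep" and Q' :: "('a, 'w) rep"
  proof -
    obtain s where s: "s \<in> Hom_G G Q Q'" "inj_on s (carrier Q)"
      using iso unfolding iso_rep_def bij_betw_def by blast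
    interpret s: intertwiner G Q Q' s
      using Q Q' s(1) by (simp add: intertwiner_def intertwiner_axioms_def)
    have "a_kernel M Q' (s \<circ> f) \<subseteq> a_kernel M Q f" if f: "f \<in> Hom_G G M Q" for f
    proof -
      interpret f: intertwiner G M Q f
        using M Q f by (simp add: intertwiner_def intertwiner_axioms_def)
      have "f v = \<zero>\<^bsub>Q\<^esub>" if "v \<in> carrier M" "s (f v) = \<zero>\<^bsub>Q'\<^esub>" for v
        by (rule inj_onD[OF s(2)]) (use that in \<open>simp_all add: s.zero f.closed\<close>)
      then show ?thesis unfolding a_kernel_def' o_apply by blast
    qed
    moreover have "(\<Inter>f\<in>Hom_G G M Q'. a_kernel M Q' f) \<subseteq> a_kernel M Q' (s \<circ> f)"
      if "f \<in> Hom_G G M Q" for f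
      by (rule INT_lower) (rule comp_Hom_G[OF that s(1)])
    ultimately show ?thesis by (intro INT_greatest) (rule subset_trans)
  qed
  show ?thesis
    unfolding isotypic_quotient_def
    using le[OF P P' iso] le[OF P' P iso_rep_sym[OF iso P]] by (metis subset_antisym)
qed

lemma irr_class_cong:
  assumes "iso_rep G V W" "representation G V"
  shows "irr_class G T V = irr_class G T W"
  unfolding irr_class_def
  using assms iso_rep_sym[OF assms] by (blast intro: iso_rep_trans)

section \<open>Quotient representations\<close>

lemma quotient_rep_simps:
  "carrier (quotient_rep V N) = a_rcosets\<^bsub>V\<^esub> N"
  "\<zero>\<^bsub>quotient_rep V N\<^esub> = N"
  "A \<oplus>\<^bsub>quotient_rep V N\<^esub> B = A <+>\<^bsub>V\<^esub> B"
  "c \<odot>\<^bsub>quotient_rep V N\<^esub> A = (\<Union>a\<in>A. N +>\<^bsub>V\<^esub> (c \<odot>\<^bsub>V\<^esub> a))"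
  "act (quotient_rep V N) g A = (\<Union>a\<in>A. N +>\<^bsub>V\<^esub> act V g a)"
  by (simp_all add: quotient_rep_def)

locale subrep = representation G V for G :: "('g, 'b) monoid_scheme" and V :: "('g, 'v) rep" +
  fixes N :: "'v set"
  assumes subrepresentation: "subrepresentation G V N"
begin

lemma submodule: "submodule N complex_field V"
  and act_mem: "\<lbrakk>g \<in> carrier G; v \<in> N\<rbrakk> \<Longrightarrow> act V g v \<in> N"
  using subrepresentation unfolding subrepresentation_def by auto

lemmas mem = submoduleD[OF submodule]

sublocale N: abelian_subgroup N V
  by (rule abelian_subgroupI3)
    (use submodule V.M.abelian_group_axioms in \<open>auto simp: submodule_def additive_subgroup_def\<close>)

lemma coset_mem_iff:
  assumes "v \<in> carrier V" "w \<in> carrier V"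
  shows "w \<in> N +>\<^bsub>V\<^esub> v \<longleftrightarrow> w \<ominus>\<^bsub>V\<^esub> v \<in> N"
  using N.a_rcos_module[OF assms] by (simp add: a_minus_def)

lemma coset_eq_iff:
  assumes "v \<in> carrier V" "w \<in> carrier V"
  shows "N +>\<^bsub>V\<^esub> w = N +>\<^bsub>V\<^esub> v \<longleftrightarrow> w \<ominus>\<^bsub>V\<^esub> v \<in> N"
  using coset_mem_iff[OF assms] N.a_repr_independence'[of w v] N.a_rcos_self[of w] assms
  by metis

lemma coset_subset: "v \<in> carrier V \<Longrightarrow> N +>\<^bsub>V\<^esub> v \<subseteq> carrier V"
  by (rule V.M.a_r_coset_subset_G[OF mem(1)])

lemma quotient_carrier: "carrier (quotient_rep V N) = (\<lambda>v. N +>\<^bsub>V\<^esub> v) ` carrier V"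
  by (auto simp: quotient_rep_simps A_RCOSETS_def')

lemma quotient_zero: "\<zero>\<^bsub>quotient_rep V N\<^esub> = N +>\<^bsub>V\<^esub> \<zero>\<^bsub>V\<^esub>"
  by (simp add: quotient_rep_simps mem(1))

lemma quotient_add:
  assumes "v \<in> carrier V" "w \<in> carrier V"
  shows "(N +>\<^bsub>V\<^esub> v) \<oplus>\<^bsub>quotient_rep V N\<^esub> (N +>\<^bsub>V\<^esub> w) = N +>\<^bsub>V\<^esub> (v \<oplus>\<^bsub>V\<^esub> w)"
  using assms by (simp add: quotient_rep_simps N.a_rcos_sum)

text \<open>The union defining the operation collapses: elements of one coset differ by elements of
  \<open>N\<close>, which is closed under scaling, so all cosets in the union coincide. For
  \<open>quotient_act\<close> the same works by stability of \<open>N\<close> under the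
  group.\<close>

lemma quotient_smult:
  assumes v: "v \<in> carrier V"
  shows "c \<odot>\<^bsub>quotient_rep V N\<^esub> (N +>\<^bsub>V\<^esub> v) = N +>\<^bsub>V\<^esub> (c \<odot>\<^bsub>V\<^esub> v)"
proof -
  have "N +>\<^bsub>V\<^esub> (c \<odot>\<^bsub>V\<^esub> a) = N +>\<^bsub>V\<^esub> (c \<odot>\<^bsub>V\<^esub> v)" if a: "a \<in> N +>\<^bsub>V\<^esub> v" for a
  proof -
    have aV: "a \<in> carrier V" using a coset_subset[OF v] by blast
    have "c \<odot>\<^bsub>V\<^esub> a \<ominus>\<^bsub>V\<^esub> c \<odot>\<^bsub>V\<^esub> v = c \<odot>\<^bsub>V\<^esub> (a \<ominus>\<^bsub>V\<^esub> v)"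
      using aV v by (simp add: a_minus_def V.smult_r_distr V.smult_r_minus)
    then show ?thesis
      using a aV v mem(4) by (simp add: coset_eq_iff coset_mem_iff)
  qed
  then show ?thesis
    unfolding quotient_rep_simps using N.a_rcos_self[OF v] by blast
qed

lemma quotient_act:
  assumes g: "g \<in> carrier G" and v: "v \<in> carrier V"
  shows "act (quotient_rep V N) g (N +>\<^bsub>V\<^esub> v) = N +>\<^bsub>V\<^esub> act V g v"
proof -
  have "N +>\<^bsub>V\<^esub> act V g a = N +>\<^bsub>V\<^esub> act V g v" if a: "a \<in> N +>\<^bsub>V\<^esub> v" for a
  proof -
    have aV: "a \<in> carrier V" using a coset_subset[OF v] by blast
    have "act V g a \<ominus>\<^bsub>V\<^esub> act V g v = act V g (a \<ominus>\<^bsub>V\<^esub> v)"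
      using aV v g by (simp add: a_minus_def neg_eq_smult act_add act_smult act_closed)
    then show ?thesis
      using a aV v g act_mem by (simp add: coset_eq_iff coset_mem_iff act_closed)
  qed
  then show ?thesis
    unfolding quotient_rep_simps using N.a_rcos_self[OF v] by blast
qed

lemma representation_quotient: "representation G (quotient_rep V N)"
proof -
  note [simp] = quotient_carrier quotient_zero quotient_add quotient_smult quotient_act act_closed
  have [simp]: "c \<odot>\<^bsub>V\<^esub> v \<in> carrier V" if "v \<in> carrier V" for c v
    using that by simp
  have ag: "abelian_group (quotient_rep V N)"
  proof (rule abelian_groupI)
    fix x assume "x \<in> carrier (quotient_rep V N)"
    then obtain v where v: "v \<in> carrier V" "x = N +>\<^bsub>V\<^esub> v" by auto
    then show "\<exists>y\<in>carrier (quotient_rep V N). y \<oplus>\<^bsub>quotient_rep V N\<^esub> x = \<zero>\<^bsub>quotient_rep V N\<^esub>"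
      by (intro bexI[of _ "N +>\<^bsub>V\<^esub> (\<ominus>\<^bsub>V\<^esub> v)"]) (auto simp: V.M.l_neg)
  qed (auto simp del: V.M.a_coset_add_zero simp: V.M.a_ac)
  have "Module.module complex_field (quotient_rep V N)"
    by (rule moduleI[OF cring_complex_field ag])
      (use V.smult_l_distr V.smult_r_distr V.smult_assoc1 V.smult_one in auto)
  moreover have "representation_axioms G (quotient_rep V N)"
    by unfold_locales (auto simp: act_add act_smult act_one act_mult)
  ultimately show ?thesis
    by (intro representation.intro G.is_group)
qed

lemma quotient_map_Hom_G: "(\<lambda>v. N +>\<^bsub>V\<^esub> v) \<in> Hom_G G V (quotient_rep V N)"
  by (auto simp: Hom_G_def hom_def quotient_carrier quotient_add quotient_smult quotient_act)

end

section \<open>Open sets and open subgroups\<close>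

context topological_group
begin

text \<open>The translate is the preimage of \<open>U\<close> under the continuous map multiplying
  by \<open>inv g\<close> on the left.\<close>

lemma openin_translate:
  assumes U: "openin T U" and g: "g \<in> carrier G"
  shows "openin T ((\<lambda>x. g \<otimes> x) ` U)"
proof -
  have "continuous_map T (prod_topology T T) (\<lambda>x. (inv g, x))"
    using g by (intro continuous_map_pairedI) (auto simp: topspace_eq)
  from continuous_map_compose[OF this continuous_mult]
  have "continuous_map T T (\<lambda>x. inv g \<otimes> x)" by (simp add: o_def)
  from openin_continuous_map_preimage[OF this U]
  have "openin T {x \<in> topspace T. inv g \<otimes> x \<in> U}" .
  moreover have "{x \<in> topspace T. inv g \<otimes> x \<in> U} = (\<lambda>x. g \<otimes> x) ` U"
  proof -
    have UG: "x \<in> carrier G" if "x \<in> U" for x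
      using that openin_subset[OF U] topspace_eq by blast
    have "x \<in> (\<lambda>x. g \<otimes> x) ` U" if "x \<in> carrier G" "inv g \<otimes> x \<in> U" for x
      using that g by (intro image_eqI[of _ _ "inv g \<otimes> x"]) (simp_all add: m_assoc[symmetric])
    then show ?thesis
      using UG g by (auto simp: topspace_eq m_assoc[symmetric])
  qed
  ultimately show ?thesis by simp
qed

text \<open>Such an \<open>H\<close> is the union of the open translates of \<open>U\<close> by its
  elements. Subsets are allowed, not just subgroups, because the lemma is also applied to the
  complement of an open subgroup.\<close>

lemma openin_of_open_subset:
  assumes H: "H \<subseteq> carrier G" and U: "openin T U" "\<one> \<in> U"
    and HU: "\<And>h u. \<lbrakk>h \<in> H; u \<in> U\<rbrakk> \<Longrightarrow> h \<otimes> u \<in> H"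
  shows "openin T H"
proof (subst openin_subopen, intro ballI exI conjI)
  fix h assume h: "h \<in> H"
  then show "openin T ((\<lambda>x. h \<otimes> x) ` U)" using H U by (intro openin_translate) auto
  show "h \<in> (\<lambda>x. h \<otimes> x) ` U" using h H U(2) by (intro image_eqI[of _ _ \<one>]) auto
  show "(\<lambda>x. h \<otimes> x) ` U \<subseteq> H" using h HU by blast
qed

text \<open>The complement is stable under right multiplication by \<open>K\<close>, hence a union
  of open left cosets.\<close>

lemma closedin_open_subgroup:
  assumes K: "subgroup K G" "openin T K"
  shows "closedin T K"
  unfolding closedin_def
proof
  interpret K: subgroup K G by (rule K)
  show "K \<subseteq> topspace T" using K.subset topspace_eq by simp
  show "openin T (topspace T - K)"
  proof (rule openin_of_open_subset[OF _ K(2) K.one_closed])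
    fix h k assume h: "h \<in> topspace T - K" and k: "k \<in> K"
    then have hG: "h \<in> carrier G" "k \<in> carrier G" using topspace_eq K.subset by auto
    have "h \<in> K" if "h \<otimes> k \<in> K"
      using K.m_closed[OF that K.m_inv_closed[OF k]] hG by (simp add: m_assoc)
    then show "h \<otimes> k \<in> topspace T - K" using h hG topspace_eq by auto
  qed (auto simp: topspace_eq)
qed

text \<open>The open subgroup \<open>H\<close> is also closed, and a closed part of a compact set is
  compact.\<close>

lemma compact_open_subgroup_Int:
  assumes "compact_open_subgroup G T K" "subgroup H G" "openin T H"
  shows "compact_open_subgroup G T (H \<inter> K)"
proof -
  have K: "subgroup K G" "compactin T K" "openin T K"
    using assms(1) unfolding compact_open_subgroup_def by auto
  have "compactin T (H \<inter> K)"
    using closedin_open_subgroup[OF assms(2,3)] K(2) by (rule closed_Int_compactin)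
  then show ?thesis
    unfolding compact_open_subgroup_def
    using subgroups_Inter_pair[OF assms(2) K(1)] assms(3) K(3) by auto
qed

end

section \<open>Stabilizers and smoothness of quotients\<close>

context representation
begin

lemma subgroup_stabilizer_of:
  assumes v: "v \<in> carrier V"
  shows "subgroup (stabilizer_of G V v) G"
proof (rule G.subgroupI)
  show "stabilizer_of G V v \<noteq> {}"
    using act_one[OF v] by (auto simp: stabilizer_of_def)
next
  fix g assume "g \<in> stabilizer_of G V v"
  then have g: "g \<in> carrier G" "act V g v = v" by (auto simp: stabilizer_of_def)
  have "act V (inv\<^bsub>G\<^esub> g) (act V g v) = v"
    using act_mult[of "inv\<^bsub>G\<^esub> g" g v] act_one[OF v] v g(1) by simp
  then show "inv\<^bsub>G\<^esub> g \<in> stabilizer_of G V v" using g by (simp add: stabilizer_of_def)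
qed (auto simp: stabilizer_of_def act_mult v)

end

text \<open>The stabilizer of a coset is stable under right multiplication by the open stabilizer of
  a representative, and is therefore open.\<close>

lemma (in subrep) smooth_quotient:
  assumes "topological_group G T" and smooth: "smooth_rep G T V"
  shows "smooth_rep G T (quotient_rep V N)"
proof -
  interpret topological_group G T by fact
  have "openin T (stabilizer_of G (quotient_rep V N) (N +>\<^bsub>V\<^esub> v))" if v: "v \<in> carrier V" for v
  proof (rule openin_of_open_subset)
    show "openin T (stabilizer_of G V v)" using smooth v unfolding smooth_rep_def by blast
    show "\<one>\<^bsub>G\<^esub> \<in> stabilizer_of G V v"
      using act_one[OF v] by (simp add: stabilizer_of_def)
  qed (use v in \<open>auto simp: stabilizer_of_def quotient_act act_mult act_closed\<close>)
  then show ?thesis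
    unfolding smooth_rep_def using representation_quotient by (auto simp: quotient_carrier)
qed

section \<open>The common kernel and the support of its quotient\<close>

text \<open>Ensures that \<open>Hom_G\<close> is nonempty, so that the intersection of all kernels
  stays inside the carrier instead of being the whole type.\<close>

lemma zero_Hom_G:
  assumes "representation G W"
  shows "(\<lambda>v. \<zero>\<^bsub>W\<^esub>) \<in> Hom_G G V W"
proof -
  interpret W: representation G W by fact
  show ?thesis by (auto simp: Hom_G_def hom_def W.V.smult_r_null W.act_zero)
qed

lemma subrep_Hom_kernel:
  assumes M: "representation G M" and P: "representation G P"
  shows "subrep G M (\<Inter>f\<in>Hom_G G M P. a_kernel M P f)"
proof -
  interpret M: representation G M by fact
  let ?N = "\<Inter>f\<in>Hom_G G M P. a_kernel M P f"
  have ker: "subrepresentation G M (a_kernel M P f)" if "f \<in> Hom_G G M P" for f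
  proof -
    interpret f: intertwiner G M P f
      using M P that by (simp add: intertwiner_def intertwiner_axioms_def)
    show ?thesis
      using f.kernel_subrepresentation[OF M.subrepresentation_carrier] by (simp add: a_kernel_def')
  qed
  have sm: "submodule (a_kernel M P f) complex_field M" if "f \<in> Hom_G G M P" for f
    using ker[OF that] unfolding subrepresentation_def by blast
  have "submodule ?N complex_field M"
  proof (rule M.submodule_complexI)
    show "?N \<subseteq> carrier M" using zero_Hom_G[OF P] by (auto simp: a_kernel_def')
  qed (auto intro: M.submoduleD(2-)[OF sm])
  moreover have "act M g v \<in> ?N" if "g \<in> carrier G" "v \<in> ?N" for g v
    using that ker unfolding subrepresentation_def by blast
  ultimately show ?thesis
    by (intro subrep.intro subrep_axioms.intro M) (auto simp: subrepresentation_def)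
qed

text \<open>Admissibility of \<open>P\<close> replaces all of \<open>Hom_G G M P\<close> by finitely
  many maps, at the price of passing from \<open>M\<close> to the subrepresentation generated by
  \<open>m\<close>.\<close>

lemma (in topological_group) iso_rep_of_Hom_kernel_le:
  assumes K: "compact_open_subgroup G T K\<^sub>0" and M: "smooth_rep G T M"
    and P: "irreducible_rep G P" "admissible_rep G T P"
    and R: "irreducible_rep G R" and f: "f \<in> Hom_G G M R"
    and le: "\<And>m. \<lbrakk>m \<in> carrier M; \<forall>p\<in>Hom_G G M P. p m = \<zero>\<^bsub>P\<^esub>\<rbrakk> \<Longrightarrow> f m = \<zero>\<^bsub>R\<^esub>"
    and m: "m \<in> carrier M" "f m \<noteq> \<zero>\<^bsub>R\<^esub>"
  shows "iso_rep G P R"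
proof -
  interpret M: representation G M using M unfolding smooth_rep_def by blast
  interpret P: representation G P using P(1) unfolding irreducible_rep_def by blast
  have hom: "intertwiner G M P p" if "p \<in> Hom_G G M P" for p
    using that M.representation_axioms P.representation_axioms
    by (simp add: intertwiner_def intertwiner_axioms_def)
  \<comment> \<open>Smoothness makes the stabilizer of \<open>m\<close> open; intersecting with
    \<open>K\<^sub>0\<close> makes it compact. Each \<open>p m\<close> is then fixed by
    \<open>K\<close>.\<close>
  define K where "K = stabilizer_of G M m \<inter> K\<^sub>0"
  have "compact_open_subgroup G T K"
    unfolding K_def using K M m(1) M.subgroup_stabilizer_of[OF m(1)]
    by (intro compact_open_subgroup_Int) (auto simp: smooth_rep_def)
  then have fin: "finite_dim P (fixed_vectors P K)"
    using P(2) unfolding admissible_rep_def by blast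
  have fixed: "(\<lambda>p. p m) ` Hom_G G M P \<subseteq> fixed_vectors P K"
  proof (rule image_subsetI)
    fix p assume "p \<in> Hom_G G M P"
    then interpret p: intertwiner G M P p by (rule hom)
    show "p m \<in> fixed_vectors P K"
      using m(1) p.equivariant[OF _ m(1)] p.closed
      by (auto simp: fixed_vectors_def K_def stabilizer_of_def) metis
  qed
  obtain E where E: "finite E" "E \<subseteq> (\<lambda>p. p m) ` Hom_G G M P"
    and gen: "\<And>U. \<lbrakk>submodule U complex_field P; E \<subseteq> U\<rbrakk> \<Longrightarrow> (\<lambda>p. p m) ` Hom_G G M P \<subseteq> U"
    using P.finite_dim_subset_generated[OF fin _ fixed]
    by (auto simp: fixed_vectors_def)
  obtain F where F: "F \<subseteq> Hom_G G M P" "finite F" "E = (\<lambda>p. p m) ` F"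
    using finite_subset_image[OF E] by blast
  let ?W = "{orbit_sum M m S a | S a. finite S \<and> S \<subseteq> carrier G}"
  show ?thesis
  proof (rule iso_rep_of_finite_kernel_le[OF P(1) R M.representation_axioms F(2,1) f])
    show "subrepresentation G M ?W" by (rule M.orbit_span_subrepresentation[OF m(1)])
    \<comment> \<open>The vector \<open>m\<close> lies in its own orbit span, with coefficient 1 at
      the identity.\<close>
    have "m = orbit_sum M m {\<one>} (\<lambda>_. 1)"
      unfolding orbit_sum_def using m(1) M.V.smult_one M.act_one by simp
    then show "\<exists>w\<in>?W. f w \<noteq> \<zero>\<^bsub>R\<^esub>"
      using m(2) by (intro bexI[of _ m]) (auto intro!: exI[of _ "{\<one>}"])
  next
    fix w assume w: "w \<in> ?W" "\<forall>p\<in>F. p w = \<zero>\<^bsub>P\<^esub>"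
    then obtain S a where S: "finite S" "S \<subseteq> carrier G" "w = orbit_sum M m S a" by blast
    \<comment> \<open>Here \<open>w\<close> is a group algebra element applied to \<open>m\<close>,
      so \<open>p w\<close> is the same element applied to \<open>p m\<close>. The vectors of
      \<open>P\<close> it kills form a submodule containing \<open>E\<close>, hence containing every
      \<open>p m\<close>.\<close>
    let ?U = "{v \<in> carrier P. orbit_sum P v S a = \<zero>\<^bsub>P\<^esub>}"
    have pw: "p w = orbit_sum P (p m) S a" "p m \<in> carrier P" if "p \<in> Hom_G G M P" for p
      using intertwiner.orbit_sum[OF hom[OF that] S(1,2) m(1)]
        intertwiner.closed[OF hom[OF that] m(1)] S(3) by auto
    have "E \<subseteq> ?U" unfolding F(3) using pw w(2) F(1) by fastforce
    then have "(\<lambda>p. p m) ` Hom_G G M P \<subseteq> ?U"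
      by (intro gen P.orbit_sum_kernel_submodule S)
    then have "\<forall>p\<in>Hom_G G M P. p w = \<zero>\<^bsub>P\<^esub>" using pw by auto
    moreover have "w \<in> carrier M" using S M.orbit_sum_closed[OF m(1)] by blast
    ultimately show "f w = \<zero>\<^bsub>R\<^esub>" by (intro le)
  qed
qed

text \<open>A nonzero map from the quotient to an irreducible \<open>R\<close>, pulled back to
  \<open>M\<close>, vanishes on the common kernel \<open>N\<close>, which forces \<open>R\<close> to
  be isomorphic to \<open>P\<close>. Admissibility is assumed of \<open>P\<close> itself, since
  \<open>tame\<close> speaks only of representations on the standard carrier type.\<close>

lemma in_R_pi_isotypic_quotient:
  fixes G :: "('g, 'b) monoid_scheme"
  assumes G: "ell_c_group G T" and M: "smooth_rep G T M"
    and P: "irreducible_rep G P" "admissible_rep G T P"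
  shows "in_R_pi G T (irr_class G T P) (isotypic_quotient G M P)"
proof -
  interpret ell_c_group G T by fact
  have Mr: "representation G M" and Pr: "representation G P"
    using M P unfolding smooth_rep_def irreducible_rep_def by auto
  define N where "N = (\<Inter>f\<in>Hom_G G M P. a_kernel M P f)"
  interpret N: subrep G M N unfolding N_def by (rule subrep_Hom_kernel[OF Mr Pr])
  have Q: "isotypic_quotient G M P = quotient_rep M N"
    by (simp add: isotypic_quotient_def N_def)
  \<comment> \<open>Any compact open subgroup will do; covering the identity element supplies
    one.\<close>
  obtain K\<^sub>0 where K: "compact_open_subgroup G T K\<^sub>0" using covered[OF one_closed] by blast
  have "C = irr_class G T P" if C: "C \<in> Supp G T (quotient_rep M N)" for C
  proof -
    obtain R f x where RC: "R \<in> C" and f: "f \<in> Hom_G G (quotient_rep M N) R"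
      and x: "x \<in> carrier (quotient_rep M N)" "f x \<noteq> \<zero>\<^bsub>R\<^esub>" and Cc: "C \<in> irr_classes G T"
      using C unfolding Supp_def by blast
    obtain V :: "'g std_rep" where V: "irreducible_smooth G T V" "C = irr_class G T V"
      using Cc unfolding irr_classes_def by blast
    have R: "irreducible_smooth G T R" "iso_rep G V R"
      using RC unfolding V(2) irr_class_def by auto
    then have Rr: "irreducible_rep G R" "representation G R"
      by (auto simp: irreducible_smooth_def irreducible_rep_def)
    interpret f: intertwiner G "quotient_rep M N" R f
      using N.representation_quotient Rr(2) f by (simp add: intertwiner_def intertwiner_axioms_def)
    obtain m where m: "m \<in> carrier M" "x = N +>\<^bsub>M\<^esub> m" using x(1) N.quotient_carrier by blast
    have "iso_rep G P R"
    proof (rule iso_rep_of_Hom_kernel_le[OF K M P Rr(1)])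
      show "f \<circ> (\<lambda>v. N +>\<^bsub>M\<^esub> v) \<in> Hom_G G M R"
        by (rule comp_Hom_G[OF N.quotient_map_Hom_G f])
      show "m \<in> carrier M" "(f \<circ> (\<lambda>v. N +>\<^bsub>M\<^esub> v)) m \<noteq> \<zero>\<^bsub>R\<^esub>" using m x(2) by auto
    next
      fix m assume "m \<in> carrier M" "\<forall>p\<in>Hom_G G M P. p m = \<zero>\<^bsub>P\<^esub>"
      then have "m \<in> N" unfolding N_def by (simp add: a_kernel_def')
      then have "N +>\<^bsub>M\<^esub> m = \<zero>\<^bsub>quotient_rep M N\<^esub>"
        by (simp add: quotient_rep_simps N.N.a_rcos_const)
      then show "(f \<circ> (\<lambda>v. N +>\<^bsub>M\<^esub> v)) m = \<zero>\<^bsub>R\<^esub>" by (simp add: f.zero)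
    qed
    \<comment> \<open>The class \<open>C\<close> is that of \<open>V\<close>, and both
      \<open>V\<close> and \<open>P\<close> are isomorphic to \<open>R\<close>.\<close>
    moreover have "representation G V"
      using V(1) by (simp add: irreducible_smooth_def irreducible_rep_def)
    ultimately show ?thesis
      using irr_class_cong[OF R(2)] irr_class_cong[of G P R] Pr V(2) by simp
  qed
  then show ?thesis
    unfolding in_R_pi_def Q using N.smooth_quotient[OF topological_group_axioms M] by blast
qed

theorem lemma1p6:
  fixes G :: "('g, 'b) monoid_scheme" and T :: "'g topology"
    and M :: "('g, 'm) rep" and P :: "('g, 'v) rep"
  assumes "ell_c_group G T"
    and "tame G T"
    and "smooth_rep G T M"
    and "irreducible_smooth G T P"
  shows "in_R_pi G T (irr_class G T P) (isotypic_quotient G M P)"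
proof -
  \<comment> \<open>Tameness applies to the copy \<open>P'\<close> on the standard carrier type.
    Replacing \<open>P\<close> by \<open>P'\<close> changes neither the class nor the
    quotient.\<close>
  obtain P' :: "'g std_rep" where P': "irreducible_smooth G T P'" "iso_rep G P P'"
    using irreducible_smooth_has_std_copy[OF assms(4)] by blast
  have reps: "representation G M" "representation G P" "representation G P'"
    using assms(3,4) P'(1)
    by (auto simp: smooth_rep_def irreducible_smooth_def irreducible_rep_def)
  have "in_R_pi G T (irr_class G T P') (isotypic_quotient G M P')"
    using assms(1-3) P'(1)
    by (intro in_R_pi_isotypic_quotient) (auto simp: tame_def irreducible_smooth_def)
  then show ?thesis
    using irr_class_cong[OF P'(2) reps(2)] isotypic_quotient_cong[OF reps P'(2)] by simp
qed

end
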